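(* Consider the functions $f:\mathbb{R}^d\times\mathbb{R}^d\to\mathbb{R}$ and $g:\mathbb{S}^{2d\times 2d}\to\mathbb{R}$ defined by $$ f(x,y)=\|x-y\|_2^2,\qquad g(M)=\operatorname{tr}\left(\begin{bmatrix} I & -I\\ -I & I\end{bmatrix}M\right). $$ Let $x,y\in\mathbb{R}^d$ and $M\in\mathbb{S}^{2d\times 2d}$. If $$ \begin{bmatrix} M & \begin{bmatrix} x\\ y\end{bmatrix}\\ \begin{bmatrix} x^T & y^T\end{bmatrix} & 1\end{bmatrix}\succeq 0, $$ then $g(M)\ge f(x,y)$.
   Context: $\mathbb{S}^{m\times m}$ denotes the set of real symmetric $m\times m$ matrices, $I$ is the $d\times d$ identity matrix, and $\succeq 0$ means positive semidefinite. *)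

theory Defs
  imports "HOL-Analysis.Analysis"
begin

(* A sum type indexes block vectors and block matrices: Inl is the first block,
   Inr the second. In the type 'a ^ 'cols ^ 'rows the row index comes last, but it is
   the first one to be applied: A $ row $ column. *)

definition block_vector :: "'a ^ 'm \<Rightarrow> 'a ^ 'n \<Rightarrow> 'a ^ ('m + 'n)" where
  "block_vector x y = (\<chi> i. case i of Inl p \<Rightarrow> x $ p | Inr p \<Rightarrow> y $ p)"

(* block_matrix A B C D has rows [A B] and [C D]. *)
definition block_matrix ::
  "'a ^ 'n ^ 'm \<Rightarrow> 'a ^ 'q ^ 'm \<Rightarrow> 'a ^ 'n ^ 'p \<Rightarrow> 'a ^ 'q ^ 'p
    \<Rightarrow> 'a ^ ('n + 'q) ^ ('m + 'p)" where
  "block_matrix A B C D =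
    (\<chi> i j. case i of
        Inl r \<Rightarrow> (case j of Inl s \<Rightarrow> A $ r $ s | Inr s \<Rightarrow> B $ r $ s)
      | Inr r \<Rightarrow> (case j of Inl s \<Rightarrow> C $ r $ s | Inr s \<Rightarrow> D $ r $ s))"

definition symmetric_matrices :: "(real ^ 'm ^ 'm) set" where
  "symmetric_matrices = {A. transpose A = A}"

definition positive_semidefinite :: "real ^ 'm ^ 'm \<Rightarrow> bool" where
  "positive_semidefinite A \<longleftrightarrow> A \<in> symmetric_matrices \<and> (\<forall>v. 0 \<le> v \<bullet> (A *v v))"

end

theory Submission
  imports Defs
begin

text \<open>
  Write \<open>z\<close> for the stacked vector of \<open>x\<close> and \<open>y\<close>, and let \<open>w k\<close> be the difference of the two
  basis vectors with index \<open>k\<close> in the first and in the second block. The weight matrix factors as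
  the sum of the rank-one matrices \<open>w k (w k)\<^sup>T\<close>, so its trace pairing with \<open>M\<close> is the sum of
  the quadratic forms \<open>w k \<bullet> (M *v w k)\<close> (\<open>trace_difference_form\<close>). Since \<open>w k \<bullet> z\<close> is the
  \<open>k\<close>-th coordinate of \<open>x - y\<close>, the squared distance is the sum of the numbers
  \<open>(w k \<bullet> z)\<^sup>2\<close>. It remains to compare the two sums term by term: positive semidefiniteness of
  the bordered matrix gives \<open>(w \<bullet> z)\<^sup>2 \<le> w \<bullet> (M *v w)\<close> for every \<open>w\<close>, that is,
  \<open>M\<close> dominates \<open>z z\<^sup>T\<close> (\<open>bordered_psd_imp_square_le\<close>).
\<close>

lemma sum_UNIV_Plus:
  fixes h :: "'a::finite + 'b::finite \<Rightarrow> 'c::comm_monoid_add"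
  shows "sum h UNIV = (\<Sum>i\<in>UNIV. h (Inl i)) + (\<Sum>j\<in>UNIV. h (Inr j))"
  by (subst UNIV_Plus_UNIV[symmetric], subst sum.Plus) (simp_all add: o_def)

lemma inner_block_vector:
  fixes a c :: "real ^ 'm" and b d :: "real ^ 'n"
  shows "block_vector a b \<bullet> block_vector c d = a \<bullet> c + b \<bullet> d"
  by (simp add: inner_vec_def block_vector_def sum_UNIV_Plus)

lemma block_matrix_mult_block_vector:
  fixes A :: "real ^ 'n ^ 'm" and B :: "real ^ 'q ^ 'm"
    and C :: "real ^ 'n ^ 'p" and D :: "real ^ 'q ^ 'p"
  shows "block_matrix A B C D *v block_vector a b
    = block_vector (A *v a + B *v b) (C *v a + D *v b)"
  by (simp add: vec_eq_iff matrix_vector_mult_def block_matrix_def block_vector_def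
      sum_UNIV_Plus split: sum.split)

text \<open>
  This is one half of the Schur complement criterion. The quadratic form of the bordered matrix at
  \<open>w\<close> extended by a scalar \<open>t\<close> is \<open>w \<bullet> (M *v w) + 2 * t * (w \<bullet> z) + t\<^sup>2\<close>; its
  minimum over \<open>t\<close>, attained at \<open>t = - (w \<bullet> z)\<close>, is \<open>w \<bullet> (M *v w) - (w \<bullet> z)\<^sup>2\<close>.
\<close>

lemma bordered_psd_imp_square_le:
  fixes M :: "real ^ 'n ^ 'n" and z w :: "real ^ 'n"
  assumes "positive_semidefinite
    (block_matrix M (columnvector z :: real ^ 1 ^ 'n) (rowvector z :: real ^ 'n ^ 1) (mat 1))"
  shows "(w \<bullet> z)\<^sup>2 \<le> w \<bullet> (M *v w)"
proof -
  define t :: "real ^ 1" where "t = vec (- (w \<bullet> z))"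
  have column: "columnvector z *v t = (- (w \<bullet> z)) *\<^sub>R z"
    by (simp add: vec_eq_iff matrix_vector_mult_def columnvector_def t_def)
  have row: "t \<bullet> (rowvector z *v w) = - (w \<bullet> z)\<^sup>2"
    by (simp add: inner_vec_def matrix_vector_mult_def rowvector_def t_def
        power2_eq_square mult.commute)
  have corner: "t \<bullet> t = (w \<bullet> z)\<^sup>2"
    by (simp add: inner_vec_def t_def power2_eq_square)
  have "0 \<le> block_vector w t \<bullet>
      (block_matrix M (columnvector z) (rowvector z) (mat 1) *v block_vector w t)"
    using assms unfolding positive_semidefinite_def by blast
  also have "\<dots> = w \<bullet> (M *v w) - (w \<bullet> z)\<^sup>2"
    by (simp add: block_matrix_mult_block_vector inner_block_vector inner_add_right
        inner_diff_right column row
        corner power2_eq_square)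
  finally show ?thesis by simp
qed

text \<open>
  The weight matrix is the sum of \<open>w w\<^sup>T\<close> over the vectors
  \<open>w = axis (Inl k) 1 - axis (Inr k) 1\<close>, and the trace of \<open>w w\<^sup>T N\<close> is the quadratic form of
  \<open>N\<close> at \<open>w\<close>.
\<close>

lemma trace_difference_form:
  fixes N :: "real ^ ('d + 'd) ^ ('d::finite + 'd)"
  shows "trace (block_matrix (mat 1) (- mat 1) (- mat 1) (mat 1) ** N)
    = (\<Sum>k\<in>UNIV. (axis (Inl k) 1 - axis (Inr k) 1) \<bullet> (N *v (axis (Inl k) 1 - axis (Inr k) 1)))"
proof -
  have "trace (block_matrix (mat 1) (- mat 1) (- mat 1) (mat 1) ** N)
    = (\<Sum>k\<in>UNIV. N $ Inl k $ Inl k - N $ Inr k $ Inl k)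
      + (\<Sum>k\<in>UNIV. N $ Inr k $ Inr k - N $ Inl k $ Inr k)"
    by (simp add: trace_def matrix_matrix_mult_def block_matrix_def mat_def sum_UNIV_Plus
        if_distrib[where f = uminus] if_distribR sum_negf
        if_distrib[where f = "\<lambda>c. c * _"] cong: if_cong)
  also have "\<dots> = (\<Sum>k\<in>UNIV. (axis (Inl k) 1 - axis (Inr k) 1)
      \<bullet> (N *v (axis (Inl k) 1 - axis (Inr k) 1)))"
    by (simp add: matrix_vector_mult_diff_distrib matrix_vector_mult_basis inner_diff_left
        inner_diff_right inner_axis' column_def sum.distrib sum_subtractf)
  finally show ?thesis .
qed

theorem proposition4p1:
  fixes f :: "real ^ 'd \<Rightarrow> real ^ 'd \<Rightarrow> real"
    and g :: "real ^ ('d + 'd) ^ ('d + 'd) \<Rightarrow> real"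
    and x y :: "real ^ 'd"
    and M :: "real ^ ('d + 'd) ^ ('d + 'd)"
  assumes f_def: "\<And>u v. f u v = (norm (u - v))\<^sup>2"
    and g_def: "\<And>N. N \<in> symmetric_matrices \<Longrightarrow>
      g N = trace (block_matrix (mat 1) (- mat 1) (- mat 1) (mat 1) ** N)"
    and M_sym: "M \<in> symmetric_matrices"
    and psd: "positive_semidefinite
      (block_matrix M (columnvector (block_vector x y) :: real ^ 1 ^ ('d + 'd))
        (rowvector (block_vector x y) :: real ^ ('d + 'd) ^ 1) (mat 1))"
  shows "g M \<ge> f x y"
proof -
  define w :: "'d \<Rightarrow> real ^ ('d + 'd)" where "w k = axis (Inl k) 1 - axis (Inr k) 1" for k
  have coordinate: "w k \<bullet> block_vector x y = x $ k - y $ k" for k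
    by (simp add: w_def inner_diff_left inner_axis' block_vector_def)
  have "f x y = (\<Sum>k\<in>UNIV. (w k \<bullet> block_vector x y)\<^sup>2)"
    unfolding f_def power2_norm_eq_inner coordinate
    by (simp add: inner_vec_def power2_eq_square)
  also have "\<dots> \<le> (\<Sum>k\<in>UNIV. w k \<bullet> (M *v w k))"
    by (intro sum_mono bordered_psd_imp_square_le psd)
  also have "\<dots> = g M"
    by (simp add: g_def[OF M_sym] trace_difference_form w_def)
  finally show ?thesis .
qed

end
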